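(* Let $\mathbf{x}_0\in\mathbb{R}^d$ be an input with ground-truth label $y_0\in[C]$, let $r>0$, and let $\mathcal{M}_{\mathrm{WE}}$ be the Weighted Ensemble over base models $\{F_i\}_{i=1}^N$ (with confidence functions $\{f_i\}_{i=1}^N$) with weights $\{w_i\}_{i=1}^N$. Suppose $\mathcal{M}_{\mathrm{WE}}(\mathbf{x}_0)=y_0$ and all base models $F_i$ are $\beta$-smooth. (Sufficient condition) $\mathcal{M}_{\mathrm{WE}}$ is $r$-robust at $\mathbf{x}_0$ if for every $y_i\in[C]$ with $y_i\ne y_0$, $$\Big\|\sum_{j=1}^N w_j\nabla_{\mathbf{x}} f_j^{y_0/y_i}(\mathbf{x}_0)\Big\|_2\le \frac1r\sum_{j=1}^N w_j f_j^{y_0/y_i}(\mathbf{x}_0)-\beta r\sum_{j=1}^N w_j .$$ (Necessary condition) If $\mathcal{M}_{\mathrm{WE}}$ is $r$-robust at $\mathbf{x}_0$, then for every $y_i\in[C]$ with $y_i\neq y_0$, $$\Big\|\sum_{j=1}^N w_j\nabla_{\mathbf{x}} f_j^{y_0/y_i}(\mathbf{x}_0)\Big\|_2\le \frac1r\sum_{j=1}^N w_j f_j^{y_0/y_i}(\mathbf{x}_0)+\beta r\sum_{j=1}^N w_j .$$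
   Context: Classification with $C$ classes, $[C]=\{1,\dots,C\}$. A model has a confidence function $f:\mathbb{R}^d\to\Delta^C=\{\mathbf{p}\in\mathbb{R}^C_{\ge0}:\|\mathbf{p}\|_1=1\}$ and prediction $F(\mathbf{x})=\arg\max_{i\in[C]}f(\mathbf{x})_i$ (no tie-breaking rule is specified). Confidence margin: $f^{y_1/y_2}(\mathbf{x}):=f(\mathbf{x})_{y_1}-f(\mathbf{x})_{y_2}$. $r$-robustness: a prediction function $F:\mathbb{R}^d\to[C]$ is $r$-robust at $\mathbf{x}_0$ if $F(\mathbf{x})=F(\mathbf{x}_0)$ for all $\mathbf{x}\in\{\mathbf{x}_0+\boldsymbol\delta:\|\boldsymbol\delta\|_2<r\}$. Weighted Ensemble: given weights $w_i>0$, $\mathcal{M}_{\mathrm{WE}}(\mathbf{x}):=\arg\max_{i\in[C]}\sum_{j=1}^N w_j f_j(\mathbf{x})_i$. $\beta$-smoothness: a differentiable $f:\mathbb{R}^d\to\mathbb{R}^C$ is $\beta$-smooth if $\|\nabla f(\mathbf{x}_1)_j-\nabla f(\mathbf{x}_2)_j\|_2\le\beta\|\mathbf{x}_1-\mathbf{x}_2\|_2$ for all $\mathbf{x}_1,\mathbf{x}_2\in\mathbb{R}^d$ and $j\in[C]$. A model $F$ is called $\beta$-smooth if its confidence function $f$ is $\beta$-smooth. *)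

theory Defs
  imports "HOL-Analysis.Analysis"
begin

definition prob_simplex :: "(real ^ 'c) set" where
  "prob_simplex = {p. (\<forall>i. 0 \<le> p $ i) \<and> (\<Sum>i\<in>UNIV. \<bar>p $ i\<bar>) = 1}"

definition confidence_function :: "(real ^ 'd \<Rightarrow> real ^ 'c) \<Rightarrow> bool" where
  "confidence_function f \<longleftrightarrow> (\<forall>x. f x \<in> prob_simplex)"

definition confidence_margin ::
    "(real ^ 'd \<Rightarrow> real ^ 'c) \<Rightarrow> 'c \<Rightarrow> 'c \<Rightarrow> real ^ 'd \<Rightarrow> real" where
  "confidence_margin f y1 y2 x = f x $ y1 - f x $ y2"

text \<open>No tie-breaking rule is fixed: an arg-max operator is any function of the score vector
  that selects one of its maximal coordinates.  Ties may be broken in any way, as long as equal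
  score vectors yield equal predictions.\<close>

definition argmax_operator :: "(real ^ 'c \<Rightarrow> 'c) \<Rightarrow> bool" where
  "argmax_operator amax \<longleftrightarrow> (\<forall>p. is_arg_max (\<lambda>i. p $ i) (\<lambda>_. True) (amax p))"

definition weighted_ensemble ::
    "(real ^ 'c \<Rightarrow> 'c) \<Rightarrow> nat \<Rightarrow> (nat \<Rightarrow> real) \<Rightarrow> (nat \<Rightarrow> real ^ 'd \<Rightarrow> real ^ 'c) \<Rightarrow> real ^ 'd \<Rightarrow> 'c" where
  "weighted_ensemble amax N w f x = amax (\<chi> i. \<Sum>j=1..N. w j * f j x $ i)"

definition r_robust :: "(real ^ 'd \<Rightarrow> 'c) \<Rightarrow> real \<Rightarrow> real ^ 'd \<Rightarrow> bool" where
  "r_robust F r x0 \<longleftrightarrow> (\<forall>x \<in> {x0 + \<delta> |\<delta>. norm \<delta> < r}. F x = F x0)"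

text \<open>Meaningful only where \<open>h\<close> is differentiable.\<close>

definition grad :: "(real ^ 'd \<Rightarrow> real) \<Rightarrow> real ^ 'd \<Rightarrow> real ^ 'd" where
  "grad h x = (THE D. GDERIV h x :> D)"

lemma grad_eqI:
  assumes "GDERIV h x :> D"
  shows "grad h x = D"
  unfolding grad_def
proof (rule the_equality)
  fix D' assume "GDERIV h x :> D'"
  then have "(\<lambda>v. v \<bullet> D') = (\<lambda>v. v \<bullet> D)"
    using assms unfolding gderiv_def by (rule has_derivative_unique)
  then show "D' = D"
    by (metis vector_eq_ldot)
qed (rule assms)

lemma GDERIV_grad:
  assumes "h differentiable (at x)"
  shows "GDERIV h x :> grad h x"
proof -
  obtain h' where h': "(h has_derivative h') (at x)"
    using assms unfolding differentiable_def by blast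
  interpret h': bounded_linear h'
    using h' by (rule has_derivative_bounded_linear)
  have "h' = (\<lambda>v. v \<bullet> adjoint h' 1)"
    using adjoint_works[OF h'.linear, of _ 1] by (simp add: fun_eq_iff)
  then have "GDERIV h x :> adjoint h' 1"
    using h' unfolding gderiv_def by simp
  then show ?thesis
    by (simp add: grad_eqI)
qed

definition beta_smooth :: "real \<Rightarrow> (real ^ 'd \<Rightarrow> real ^ 'c) \<Rightarrow> bool" where
  "beta_smooth \<beta> f \<longleftrightarrow>
     (\<forall>x. f differentiable (at x)) \<and>
     (\<forall>x1 x2 j. norm (grad (\<lambda>x. f x $ j) x1 - grad (\<lambda>x. f x $ j) x2) \<le> \<beta> * norm (x1 - x2))"

end

theory Submission
  imports Defs
begin

text \<open>The weighted margin of \<open>y\<^sub>0\<close> against \<open>y\<close> has a gradient that is Lipschitz with constant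
  \<open>2 \<beta> \<Sum>w\<close>, so it stays within \<open>\<beta> (\<Sum>w) |\<delta>|\<^sup>2\<close> of its first-order expansion at \<open>x\<^sub>0\<close>.
  Sufficiency is this lower bound; necessity is the upper bound along the direction of steepest
  descent, in the limit of steps of length \<open>r\<close>.  The sufficient condition is not strict, so ties must
  be excluded: the quadratic term does so if \<open>\<beta> \<Sum>w > 0\<close>, and otherwise the scores are constant,
  because an affine function with values in \<open>[0, 1]\<close> is constant.\<close>

section \<open>First-order expansions with a quadratic remainder\<close>

lemma GDERIV_taylor_upper:
  assumes h: "\<And>x. GDERIV h x :> g x"
    and lip: "\<And>x y. norm (g x - g y) \<le> L * norm (x - y)"
  shows "h (x + d) \<le> h x + g x \<bullet> d + L / 2 * (norm d)\<^sup>2"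
proof -
  \<comment> \<open>The function \<open>\<phi>\<close> is \<open>h\<close> along the segment from
    \<open>x\<close> to \<open>x + d\<close>, minus the linear and quadratic terms of the bound.
    Since \<open>\<phi> 0 = h x\<close>, the claim is exactly
    \<open>\<phi> 1 \<le> \<phi> 0\<close>; Cauchy-Schwarz and the Lipschitz bound make the
    derivative nonpositive for \<open>t \<ge> 0\<close>.\<close>
  define \<phi> where "\<phi> t = h (x + t *\<^sub>R d) - t * (g x \<bullet> d) - L / 2 * (norm d)\<^sup>2 * t\<^sup>2" for t :: real
  define \<phi>' where "\<phi>' t = g (x + t *\<^sub>R d) \<bullet> d - g x \<bullet> d - L * (norm d)\<^sup>2 * t" for t :: real
  have "(\<phi> has_real_derivative \<phi>' t) (at t)" for t
  proof -
    have "((\<lambda>t. x + t *\<^sub>R d) has_derivative (\<lambda>s. s *\<^sub>R d)) (at t)"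
      by (auto intro!: derivative_eq_intros)
    moreover have "(h has_derivative (\<lambda>v. v \<bullet> g (x + t *\<^sub>R d))) (at (x + t *\<^sub>R d))"
      using h unfolding gderiv_def .
    ultimately have "((\<lambda>t. h (x + t *\<^sub>R d)) has_derivative (\<lambda>s. (s *\<^sub>R d) \<bullet> g (x + t *\<^sub>R d))) (at t)"
      by (rule has_derivative_compose)
    then have "((\<lambda>t. h (x + t *\<^sub>R d)) has_real_derivative g (x + t *\<^sub>R d) \<bullet> d) (at t)"
      unfolding has_field_derivative_def
      by (rule has_derivative_eq_rhs) (auto simp: fun_eq_iff inner_commute)
    then show ?thesis
      unfolding \<phi>_def \<phi>'_def by (auto intro!: derivative_eq_intros)
  qed
  moreover have "\<phi>' t \<le> 0" if "0 \<le> t" for t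
  proof -
    have "g (x + t *\<^sub>R d) \<bullet> d - g x \<bullet> d \<le> norm (g (x + t *\<^sub>R d) - g x) * norm d"
      by (metis inner_diff_left norm_cauchy_schwarz)
    also have "\<dots> \<le> (L * norm (t *\<^sub>R d)) * norm d"
      using lip[of "x + t *\<^sub>R d" x] by (intro mult_right_mono) auto
    finally show ?thesis
      using that by (simp add: \<phi>'_def power2_eq_square algebra_simps)
  qed
  ultimately have "\<phi> 1 \<le> \<phi> 0"
    by (intro DERIV_nonpos_imp_nonincreasing[of 0 1 \<phi>]) auto
  then show ?thesis
    by (simp add: \<phi>_def)
qed

text \<open>The upper bound applied to \<open>- h\<close>, whose gradient \<open>- g\<close> has the
  same Lipschitz constant.\<close>

lemma GDERIV_taylor_lower:
  assumes h: "\<And>x. GDERIV h x :> g x"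
    and lip: "\<And>x y. norm (g x - g y) \<le> L * norm (x - y)"
  shows "h (x + d) \<ge> h x + g x \<bullet> d - L / 2 * (norm d)\<^sup>2"
proof -
  have "- h (x + d) \<le> - h x + (- g x) \<bullet> d + L / 2 * (norm d)\<^sup>2"
  proof (rule GDERIV_taylor_upper)
    show "GDERIV (\<lambda>x. - h x) x :> - g x" for x
      using h by (rule GDERIV_minus)
    show "norm (- g x - - g y) \<le> L * norm (x - y)" for x y
      using lip[of x y] by (simp add: norm_minus_commute)
  qed
  then show ?thesis
    by simp
qed

text \<open>A constant gradient permits \<open>L = 0\<close> in both expansions, so \<open>h\<close>
  is affine; a nonzero slope would carry it out of the unit interval.\<close>

lemma bounded_GDERIV_const_imp_const:
  assumes h: "\<And>x. GDERIV h x :> c"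
    and bounds: "\<And>x. 0 \<le> h x" "\<And>x. h x \<le> (1::real)"
  shows "h x = h y"
proof -
  have affine: "h (x + d) = h x + c \<bullet> d" for x d
    using GDERIV_taylor_upper[of h "\<lambda>_. c" 0 x d] GDERIV_taylor_lower[of h "\<lambda>_. c" 0 x d] h
    by simp
  have "c = 0"
  proof (rule ccontr)
    assume "c \<noteq> 0"
    \<comment> \<open>The step along \<open>c\<close> is scaled so that \<open>h\<close> grows by 2,
      more than the length of the interval.\<close>
    then have "h (0 + (2 / (c \<bullet> c)) *\<^sub>R c) = h 0 + 2"
      unfolding affine by simp
    then show False
      using bounds(1)[of 0] bounds(2)[of "0 + (2 / (c \<bullet> c)) *\<^sub>R c"] by linarith
  qed
  then show ?thesis
    using affine[of y "x - y"] by simp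
qed

section \<open>Gradients of smooth confidence functions and of their margins\<close>

lemma beta_smooth_GDERIV:
  assumes "beta_smooth \<beta> f"
  shows "GDERIV (\<lambda>x. f x $ i) x :> grad (\<lambda>x. f x $ i) x"
proof (rule GDERIV_grad)
  have "f differentiable (at x)"
    using assms by (simp add: beta_smooth_def)
  then show "(\<lambda>x. f x $ i) differentiable (at x)"
    unfolding differentiable_def by (blast intro: bounded_linear.has_derivative[OF bounded_linear_vec_nth])
qed

lemma beta_smooth_grad_lipschitz:
  assumes "beta_smooth \<beta> f"
  shows "norm (grad (\<lambda>x. f x $ i) x - grad (\<lambda>x. f x $ i) y) \<le> \<beta> * norm (x - y)"
  using assms by (simp add: beta_smooth_def)

text \<open>The space has positive dimension, so there are two points at distance 1: the origin and
  a basis vector. Comparing the gradients there bounds \<open>\<beta>\<close> below by a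
  norm.\<close>

lemma beta_smooth_nonneg:
  fixes f :: "real ^ 'd \<Rightarrow> real ^ 'c"
  assumes "beta_smooth \<beta> f"
  shows "0 \<le> \<beta>"
proof -
  obtain b :: "real ^ 'd" where "b \<in> Basis"
    using nonempty_Basis by blast
  have "0 \<le> \<beta> * norm (b - 0)"
    using norm_ge_zero beta_smooth_grad_lipschitz[OF assms] by (rule order_trans)
  then show ?thesis
    using \<open>b \<in> Basis\<close> by simp
qed

lemma beta_smooth_margin_GDERIV:
  assumes "beta_smooth \<beta> f"
  shows "GDERIV (confidence_margin f a b) x :> grad (\<lambda>x. f x $ a) x - grad (\<lambda>x. f x $ b) x"
  unfolding confidence_margin_def[abs_def]
  using assms by (intro GDERIV_diff beta_smooth_GDERIV)

lemma grad_margin: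
  assumes "beta_smooth \<beta> f"
  shows "grad (confidence_margin f a b) x = grad (\<lambda>x. f x $ a) x - grad (\<lambda>x. f x $ b) x"
  using assms by (intro grad_eqI beta_smooth_margin_GDERIV)

text \<open>The factor 2 arises because each of the two classes in the margin contributes one
  \<open>\<beta>\<close>.\<close>

lemma grad_margin_lipschitz:
  assumes "beta_smooth \<beta> f"
  shows "norm (grad (confidence_margin f a b) x - grad (confidence_margin f a b) y)
    \<le> 2 * \<beta> * norm (x - y)"
proof -
  let ?g = "\<lambda>i. grad (\<lambda>x. f x $ i)"
  have "norm ((?g a x - ?g a y) - (?g b x - ?g b y)) \<le> norm (?g a x - ?g a y) + norm (?g b x - ?g b y)"
    by (rule norm_triangle_ineq4)
  also have "\<dots> \<le> \<beta> * norm (x - y) + \<beta> * norm (x - y)"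
    by (intro add_mono beta_smooth_grad_lipschitz assms)
  finally show ?thesis
    by (simp add: grad_margin[OF assms] algebra_simps)
qed

text \<open>Each coordinate has a constant gradient and, by the simplex constraints, values between
  0 and 1. This settles the degenerate case in which the quadratic term vanishes.\<close>

lemma beta_smooth_0_confidence_const:
  assumes "beta_smooth 0 f" "confidence_function f"
  shows "f x = f y"
proof -
  have "f x $ i = f y $ i" for i
  proof (rule bounded_GDERIV_const_imp_const[of "\<lambda>x. f x $ i"])
    show "GDERIV (\<lambda>x. f x $ i) x :> grad (\<lambda>x. f x $ i) 0" for x
      using beta_smooth_GDERIV[OF assms(1), of i x] beta_smooth_grad_lipschitz[OF assms(1), of i x 0]
      by simp
    have simplex: "\<And>k. 0 \<le> f x $ k" "(\<Sum>k\<in>UNIV. \<bar>f x $ k\<bar>) = 1" for x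
      using assms(2) unfolding confidence_function_def prob_simplex_def by blast+
    show "0 \<le> f x $ i" for x
      by (rule simplex)
    show "f x $ i \<le> 1" for x
      using member_le_sum[of i UNIV "\<lambda>k. \<bar>f x $ k\<bar>"] simplex[of x] by simp
  qed
  then show ?thesis
    by (simp add: vec_eq_iff)
qed

section \<open>Weighted sums and arg-max operators\<close>

lemma GDERIV_scaled_sum:
  assumes "\<And>j. j \<in> A \<Longrightarrow> GDERIV (h j) x :> g j"
  shows "GDERIV (\<lambda>x. \<Sum>j\<in>A. w j * h j x) x :> (\<Sum>j\<in>A. w j *\<^sub>R g j)"
proof -
  have "((\<lambda>x. \<Sum>j\<in>A. w j * h j x) has_derivative (\<lambda>v. \<Sum>j\<in>A. w j * (v \<bullet> g j))) (at x)"
    using assms unfolding gderiv_def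
    by (intro has_derivative_sum has_derivative_mult_right)
  then show ?thesis
    by (simp add: gderiv_def inner_sum_right)
qed

text \<open>A strict maximizer is unique, so every tie-breaking rule selects it.\<close>

lemma argmax_operator_eqI:
  assumes "argmax_operator amax" "\<And>y. y \<noteq> y0 \<Longrightarrow> p $ y < p $ y0"
  shows "amax p = y0"
  using assms by (auto simp: argmax_operator_def is_arg_max_def)

lemma argmax_operator_ge:
  assumes "argmax_operator amax"
  shows "p $ y \<le> p $ amax p"
  using assms by (auto simp: argmax_operator_def is_arg_max_def not_less)

theorem theorem1:
  fixes x0 :: "real ^ 'd" and y0 :: "'c::finite" and r \<beta> :: real
    and N :: nat and w :: "nat \<Rightarrow> real" and f :: "nat \<Rightarrow> real ^ 'd \<Rightarrow> real ^ 'c"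
    and amax :: "real ^ 'c \<Rightarrow> 'c"
  assumes "r > 0"
    and "argmax_operator amax"
    and "\<And>j. j \<in> {1..N} \<Longrightarrow> confidence_function (f j)"
    and "\<And>j. j \<in> {1..N} \<Longrightarrow> w j > 0"
    and "\<And>j. j \<in> {1..N} \<Longrightarrow> beta_smooth \<beta> (f j)"
    and "weighted_ensemble amax N w f x0 = y0"
  shows "((\<forall>y. y \<noteq> y0 \<longrightarrow>
            norm (\<Sum>j=1..N. w j *\<^sub>R grad (confidence_margin (f j) y0 y) x0)
              \<le> 1 / r * (\<Sum>j=1..N. w j * confidence_margin (f j) y0 y x0) - \<beta> * r * (\<Sum>j=1..N. w j))
          \<longrightarrow> r_robust (weighted_ensemble amax N w f) r x0)
       \<and> (r_robust (weighted_ensemble amax N w f) r x0 \<longrightarrow>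
          (\<forall>y. y \<noteq> y0 \<longrightarrow>
            norm (\<Sum>j=1..N. w j *\<^sub>R grad (confidence_margin (f j) y0 y) x0)
              \<le> 1 / r * (\<Sum>j=1..N. w j * confidence_margin (f j) y0 y x0) + \<beta> * r * (\<Sum>j=1..N. w j)))"
proof -
  define W where "W = (\<Sum>j=1..N. w j)"
  define G where "G y x = (\<Sum>j=1..N. w j * confidence_margin (f j) y0 y x)" for y x
  define Dg where "Dg y x = (\<Sum>j=1..N. w j *\<^sub>R grad (confidence_margin (f j) y0 y) x)" for y x
  let ?F = "weighted_ensemble amax N w f"
  let ?p = "\<lambda>x. \<chi> i. \<Sum>j=1..N. w j * f j x $ i"
  \<comment> \<open>\<open>G y\<close> is the lead of \<open>y0\<close> over \<open>y\<close> in the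
    ensemble scores, so its sign links the gradient estimates to the prediction.\<close>
  have margin: "G y x = ?p x $ y0 - ?p x $ y" for y x
    by (simp add: G_def confidence_margin_def right_diff_distrib sum_subtractf)
  have GDERIV_G: "GDERIV (G y) x :> Dg y x" for y x
    unfolding G_def Dg_def
    using assms(5) by (intro GDERIV_scaled_sum) (metis beta_smooth_margin_GDERIV grad_margin)
  have lip: "norm (Dg y x - Dg y x') \<le> (2 * \<beta> * W) * norm (x - x')" for y x x'
  proof -
    let ?g = "\<lambda>j. grad (confidence_margin (f j) y0 y)"
    have "Dg y x - Dg y x' = (\<Sum>j=1..N. w j *\<^sub>R (?g j x - ?g j x'))"
      by (simp add: Dg_def sum_subtractf scaleR_right_diff_distrib)
    also have "norm \<dots> \<le> (\<Sum>j=1..N. w j * (2 * \<beta> * norm (x - x')))"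
    proof (rule sum_norm_le)
      fix j assume j: "j \<in> {1..N}"
      show "norm (w j *\<^sub>R (?g j x - ?g j x')) \<le> w j * (2 * \<beta> * norm (x - x'))"
        using assms(4)[OF j] grad_margin_lipschitz[OF assms(5)[OF j], of y0 y x x'] by (simp add: mult.assoc)
    qed
    also have "\<dots> = (2 * \<beta> * W) * norm (x - x')"
      by (simp add: W_def sum_distrib_left sum_distrib_right mult_ac)
    finally show ?thesis .
  qed
  \<comment> \<open>The factor \<open>L / 2\<close> of the expansion cancels the 2 in the Lipschitz
    constant, which leaves the coefficient \<open>\<beta> * W\<close>.\<close>
  have upper: "G y (x0 + d) \<le> G y x0 + Dg y x0 \<bullet> d + \<beta> * W * (norm d)\<^sup>2" for y d
    using GDERIV_taylor_upper[OF GDERIV_G lip] by simp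
  have lower: "G y (x0 + d) \<ge> G y x0 + Dg y x0 \<bullet> d - \<beta> * W * (norm d)\<^sup>2" for y d
    using GDERIV_taylor_lower[OF GDERIV_G lip] by simp
  \<comment> \<open>The sign of \<open>\<beta>\<close> is known only if there is a base model; for
    \<open>N = 0\<close> the product is 0 because \<open>W\<close> is an empty sum.\<close>
  have \<beta>W_nonneg: "0 \<le> \<beta> * W"
  proof (cases "N = 0")
    case False
    then have "0 \<le> \<beta>"
      using assms(5)[of 1] beta_smooth_nonneg by auto
    moreover have "0 \<le> W"
      unfolding W_def using assms(4) by (intro sum_nonneg) (auto intro: less_imp_le)
    ultimately show ?thesis
      by simp
  qed (simp add: W_def)

  have sufficient: "r_robust ?F r x0"
    if cond: "\<And>y. y \<noteq> y0 \<Longrightarrow> norm (Dg y x0) \<le> 1 / r * G y x0 - \<beta> * r * W"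
  proof -
    have "?F (x0 + d) = y0" if d: "norm d < r" for d
    proof (cases "\<beta> * W = 0")
      case True
      \<comment> \<open>Here a tie at \<open>x0\<close> is possible, but the score vector does not
        move at all, and \<open>amax\<close> depends on that vector alone.\<close>
      have "?p (x0 + d) = ?p x0"
      proof (cases "N = 0")
        case False
        then have "0 < W"
          unfolding W_def using assms(4) by (intro sum_pos) auto
        then have "\<beta> = 0"
          using True by simp
        then have "f j (x0 + d) = f j x0" if "j \<in> {1..N}" for j
          using assms(3,5)[OF that] by (intro beta_smooth_0_confidence_const) auto
        then show ?thesis
          by (simp add: vec_eq_iff)
      qed simp
      then show ?thesis
        using assms(6) unfolding weighted_ensemble_def by simp
    next
      case False
      then have pos: "0 < \<beta> * W"
        using \<beta>W_nonneg by linarith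
      have "?p (x0 + d) $ y < ?p (x0 + d) $ y0" if "y \<noteq> y0" for y
      proof -
        have "r * norm (Dg y x0) \<le> r * (1 / r * G y x0 - \<beta> * r * W)"
          using cond[OF that] \<open>r > 0\<close> by (intro mult_left_mono) auto
        then have 1: "r * norm (Dg y x0) \<le> G y x0 - \<beta> * W * r\<^sup>2"
          using \<open>r > 0\<close> by (simp add: algebra_simps power2_eq_square)
        have "- (Dg y x0 \<bullet> d) \<le> norm (Dg y x0) * norm d"
          using norm_cauchy_schwarz[of "- Dg y x0" d] by simp
        also have "\<dots> \<le> norm (Dg y x0) * r"
          using d by (intro mult_left_mono) auto
        finally have 2: "- (Dg y x0 \<bullet> d) \<le> r * norm (Dg y x0)"
          by (simp add: mult.commute)
        \<comment> \<open>The only strict inequality: it turns the non-strict condition into a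
          positive lead, which excludes ties.\<close>
        have "\<beta> * W * (norm d)\<^sup>2 < \<beta> * W * r\<^sup>2"
          using pos d by (intro mult_strict_left_mono power_strict_mono) auto
        then have "0 < G y (x0 + d)"
          using lower[of y d] 1 2 by linarith
        then show ?thesis
          unfolding margin by linarith
      qed
      then show ?thesis
        unfolding weighted_ensemble_def by (rule argmax_operator_eqI[OF assms(2)])
    qed
    then show ?thesis
      using assms(6) by (auto simp: r_robust_def)
  qed

  have necessary: "norm (Dg y x0) \<le> 1 / r * G y x0 + \<beta> * r * W"
    if robust: "r_robust ?F r x0" for y
  proof -
    have nonneg: "0 \<le> G y (x0 + d)" if "norm d < r" for d
    proof -
      have "?F (x0 + d) = y0"
        using robust that assms(6) by (auto simp: r_robust_def)
      then show ?thesis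
        unfolding margin weighted_ensemble_def
        using argmax_operator_ge[OF assms(2), of "?p (x0 + d)" y] by simp
    qed
    \<comment> \<open>The direction of steepest ascent, followed backwards below. It is 0 if the
      gradient vanishes, hence its norm is only bounded by 1; a shorter step is harmless because
      \<open>\<beta> * W\<close> is nonnegative.\<close>
    let ?u = "sgn (Dg y x0)"
    have bound: "0 \<le> G y x0 - t * norm (Dg y x0) + \<beta> * W * t\<^sup>2" if "0 < t" "t < r" for t
    proof -
      have norm_u: "norm ?u \<le> 1"
        by (simp add: norm_sgn)
      have step: "norm (- t *\<^sub>R ?u) \<le> t"
        using that norm_u by (simp add: mult_left_le)
      then have "0 \<le> G y (x0 + (- t *\<^sub>R ?u))"
        using that by (intro nonneg) linarith
      moreover have "(norm (- t *\<^sub>R ?u))\<^sup>2 \<le> t\<^sup>2"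
        using step by (intro power_mono) auto
      moreover have "\<beta> * W * (norm (- t *\<^sub>R ?u))\<^sup>2 \<le> \<beta> * W * t\<^sup>2"
        using calculation(2) \<beta>W_nonneg by (rule mult_left_mono)
      moreover have "Dg y x0 \<bullet> (- t *\<^sub>R ?u) = - t * norm (Dg y x0)"
        by (cases "Dg y x0 = 0") (simp_all add: sgn_div_norm dot_square_norm power2_eq_square)
      ultimately show ?thesis
        using upper[of y "- t *\<^sub>R ?u"] by linarith
    qed
    have "((\<lambda>t. G y x0 - t * norm (Dg y x0) + \<beta> * W * t\<^sup>2) \<longlongrightarrow>
        G y x0 - r * norm (Dg y x0) + \<beta> * W * r\<^sup>2) (at_left r)"
      by (intro tendsto_intros)
    moreover have "\<forall>\<^sub>F t in at_left r. 0 \<le> G y x0 - t * norm (Dg y x0) + \<beta> * W * t\<^sup>2"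
      using eventually_at_left_real[OF \<open>r > 0\<close>] by eventually_elim (simp add: bound)
    ultimately have "0 \<le> G y x0 - r * norm (Dg y x0) + \<beta> * W * r\<^sup>2"
      by (rule tendsto_lowerbound) simp
    then show ?thesis
      using \<open>r > 0\<close> by (simp add: field_simps power2_eq_square)
  qed

  show ?thesis
    using sufficient necessary unfolding W_def G_def Dg_def by blast
qed

end
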